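(* Let $G$ be a nonempty graph of order $n$, and let $k$ be an integer with $1\le k\le n$. Then $\mathrm{str}(G)\geq 2n-k+1$ if and only if the complement $\overline{G}$ does not contain $F_k$ as a subgraph.
   Context: All graphs are finite and simple; a graph is nonempty if it has at least one edge. Subgraphs are not necessarily induced. A numbering of a graph $G$ of order $n$ is a bijection $g:V(G)\to\{1,\dots,n\}$. For a nonempty graph $G$, $\mathrm{str}_g(G)=\max\{g(u)+g(v) : uv\in E(G)\}$, and the strength of $G$ is $\mathrm{str}(G)=\min\{\mathrm{str}_g(G) : g \text{ is a numbering of } G\}$. Let $F_1=K_1$, and for integers $k\geq 2$ let $F_k$ be the graph with vertex set $\{v_i : 1\le i\le k\}$ and edge set $\{v_iv_j : 1\le i\le \lfloor k/2\rfloor,\ i+1\le j\le k+1-i\}$. *)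

theory Defs
  imports "Graph_Theory.Pair_Digraph" "Graph_Theory.Digraph_Isomorphism"
begin

text \<open>
  Finite simple graphs are represented by the locale \<^locale>\<open>pair_graph\<close>: an edge
  \<open>uv\<close> is the pair of opposite arcs \<open>(u, v)\<close> and \<open>(v, u)\<close>.
\<close>

definition numbering :: "'a pair_pre_digraph \<Rightarrow> ('a \<Rightarrow> nat) \<Rightarrow> bool" where
  "numbering G g \<longleftrightarrow> bij_betw g (pverts G) {1..card (pverts G)}"

definition strength_wrt :: "('a \<Rightarrow> nat) \<Rightarrow> 'a pair_pre_digraph \<Rightarrow> nat" where
  "strength_wrt g G = Max {g u + g v | u v. (u, v) \<in> parcs G}"

text \<open>
  A numbering is a total function, so there may be infinitely many of them (they are
  arbitrary off the vertex set); the set of values below is nevertheless finite and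
  nonempty, see the lemmas \<open>finite_strengths\<close> and \<open>strengths_nonempty\<close>.
\<close>
definition strength :: "'a pair_pre_digraph \<Rightarrow> nat" where
  "strength G = Min {strength_wrt g G | g. numbering G g}"

definition graph_complement :: "'a pair_pre_digraph \<Rightarrow> 'a pair_pre_digraph" where
  "graph_complement G =
     \<lparr> pverts = pverts G,
       parcs = {(u, v). u \<in> pverts G \<and> v \<in> pverts G \<and> u \<noteq> v \<and> (u, v) \<notin> parcs G} \<rparr>"

definition contains_subgraph :: "'a pair_pre_digraph \<Rightarrow> 'b pair_pre_digraph \<Rightarrow> bool" where
  "contains_subgraph G F \<longleftrightarrow>
     (\<exists>H :: 'a pair_pre_digraph. subgraph (with_proj H) (with_proj G) \<and>
                                  digraph_iso (with_proj F) (with_proj H))"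

definition F_edges :: "nat \<Rightarrow> nat rel" where
  "F_edges k = {(i, j). 1 \<le> i \<and> i \<le> k div 2 \<and> i + 1 \<le> j \<and> j \<le> k + 1 - i}"

text \<open>
  The vertex \<open>v\<^sub>i\<close> is the number \<open>i\<close>. For \<open>k = 1\<close> the formula yields the graph with
  one vertex and no edge, as it should (\<open>F_graph_1\<close>).
\<close>
definition F_graph :: "nat \<Rightarrow> nat pair_pre_digraph" where
  "F_graph k = \<lparr> pverts = {1..k}, parcs = F_edges k \<union> (F_edges k)\<inverse> \<rparr>"

lemma F_graph_1: "F_graph 1 = \<lparr> pverts = {1}, parcs = {} \<rparr>"
  by (auto simp: F_graph_def F_edges_def)

lemma pair_graph_F_graph: "pair_graph (F_graph k)"
proof -
  have "parcs (F_graph k) \<subseteq> {1..k} \<times> {1..k}"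
    by (auto simp: F_graph_def F_edges_def)
  then have "finite (parcs (F_graph k))"
    by (rule finite_subset) simp
  then show ?thesis
    by unfold_locales (auto simp: F_graph_def F_edges_def symmetric_def sym_def)
qed

lemma pair_graph_graph_complement:
  assumes "pair_graph G"
  shows "pair_graph (graph_complement G)"
proof -
  interpret pair_graph G by fact
  have "parcs (graph_complement G) \<subseteq> pverts G \<times> pverts G"
    by (auto simp: graph_complement_def)
  then have "finite (parcs (graph_complement G))"
    by (rule finite_subset) (simp add: pair_finite_verts)
  then show ?thesis
    using pair_sym_arcs
    by unfold_locales (auto simp: graph_complement_def symmetric_def sym_def pair_finite_verts)
qed

lemma strengths_nonempty:
  assumes "pair_graph G"
  shows "{strength_wrt g G | g. numbering G g} \<noteq> {}"
proof -
  interpret pair_graph G by fact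
  have "\<exists>g. bij_betw g (pverts G) {1..card (pverts G)}"
    by (rule finite_same_card_bij) (auto simp: pair_finite_verts)
  then show ?thesis
    by (auto simp: numbering_def)
qed

lemma finite_strengths:
  assumes "pair_graph G" and "parcs G \<noteq> {}"
  shows "finite {strength_wrt g G | g. numbering G g}"
proof -
  interpret pair_graph G by fact
  have "strength_wrt g G \<le> 2 * card (pverts G)" if "numbering G g" for g
  proof -
    let ?S = "{g u + g v | u v. (u, v) \<in> parcs G}"
    have "?S = (\<lambda>e. g (fst e) + g (snd e)) ` parcs G"
      by force
    then have "finite ?S" and "?S \<noteq> {}"
      using pair_finite_arcs assms(2) by auto
    moreover have "x \<le> 2 * card (pverts G)" if "x \<in> ?S" for x
    proof -
      obtain u v where x: "x = g u + g v" and uv: "(u, v) \<in> parcs G"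
        using \<open>x \<in> ?S\<close> by blast
      have "g w \<le> card (pverts G)" if "w \<in> pverts G" for w
        using \<open>numbering G g\<close> that bij_betwE by (fastforce simp: numbering_def)
      then have "g u \<le> card (pverts G)" "g v \<le> card (pverts G)"
        using uv in_arcsD1 in_arcsD2 by blast+
      then show ?thesis using x by simp
    qed
    ultimately show ?thesis
      unfolding strength_wrt_def by simp
  qed
  then have "{strength_wrt g G | g. numbering G g} \<subseteq> {..2 * card (pverts G)}"
    by auto
  then show ?thesis
    by (rule finite_subset) simp
qed

end

theory Submission
  imports Defs
begin

text \<open>
  A numbering \<open>g\<close> of a graph of order \<open>n\<close> can be read backwards: \<open>h v = n + 1 - g v\<close> is again a
  numbering, and \<open>g u + g v \<le> 2 * n - k\<close> says the same as \<open>h u + h v \<ge> k + 2\<close>. So the strength is at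
  most \<open>2 * n - k\<close> if and only if some numbering \<open>h\<close> has \<open>h u + h v \<ge> k + 2\<close> on every edge, that is,
  if and only if two distinct vertices with \<open>h u + h v \<le> k + 1\<close> are always adjacent in the
  complement (\<open>strength_le_iff_lower_bounded_numbering\<close>).

  The graph \<open>F\<^sub>k\<close> encodes just this condition: distinct vertices \<open>i\<close> and \<open>j\<close> are adjacent in it if
  and only if \<open>i + j \<le> k + 1\<close> (\<open>parcs_F_graph_iff\<close>). Hence sending \<open>i \<le> k\<close> to the vertex with
  \<open>h\<close>-number \<open>i\<close> embeds \<open>F\<^sub>k\<close> into the complement. Conversely, an embedding of \<open>F\<^sub>k\<close>
  labels \<open>k\<close> vertices with \<open>1, \<dots>, k\<close>; label the others in any way with \<open>k + 1, \<dots>, n\<close>.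
  A label above \<open>k\<close> already forces a sum of at least \<open>k + 2\<close>, so only edges between the
  first \<open>k\<close> vertices matter, and those are controlled by the embedding
  (\<open>complement_contains_F_graph_iff\<close>).
\<close>

text \<open>
  The copy of \<open>F\<close> required by \<^const>\<open>contains_subgraph\<close> is the image of \<open>F\<close> under the embedding.
  In a digraph of the form \<^term>\<open>with_proj H\<close> the arcs are determined by their ends, so the
  action of an isomorphism on arcs is determined by its action on vertices.
\<close>
lemma contains_subgraph_iff_embedding:
  assumes "pair_wf_digraph G" and "pair_wf_digraph F"
  shows "contains_subgraph G F \<longleftrightarrow>
    (\<exists>f. inj_on f (pverts F) \<and> f ` pverts F \<subseteq> pverts G \<and>
         (\<forall>i j. (i, j) \<in> parcs F \<longrightarrow> (f i, f j) \<in> parcs G))"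
    (is "_ \<longleftrightarrow> (\<exists>f. ?emb f)")
proof
  assume "contains_subgraph G F"
  then obtain H hom where sub: "subgraph (with_proj H) (with_proj G)"
    and iso: "pre_digraph.digraph_isomorphism (with_proj F) hom"
    and H: "with_proj H = app_iso hom (with_proj F)"
    unfolding contains_subgraph_def digraph_iso_def by blast
  define f where "f = iso_verts hom"
  have pvertsH: "pverts H = f ` pverts F"
    using arg_cong[OF H, of verts] by (simp add: f_def)
  have parcsH: "parcs H = iso_arcs hom ` parcs F"
    using arg_cong[OF H, of arcs] by simp
  have ends: "iso_tail hom = fst" "iso_head hom = snd"
    using arg_cong[OF H, of tail] arg_cong[OF H, of head] by simp_all
  have "iso_arcs hom (i, j) = (f i, f j)" if "(i, j) \<in> parcs F" for i j
    using iso that unfolding pre_digraph.digraph_isomorphism_def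
    by (auto simp: ends f_def prod_eq_iff)
  then have "(f i, f j) \<in> parcs H" if "(i, j) \<in> parcs F" for i j
    using that parcsH by force
  moreover have "inj_on f (pverts F)"
    using iso unfolding pre_digraph.digraph_isomorphism_def by (simp add: f_def)
  ultimately have "?emb f"
    using sub pvertsH by (auto simp: subgraph_def)
  then show "\<exists>f. ?emb f" by blast
next
  assume "\<exists>f. ?emb f"
  then obtain f where f: "?emb f" by blast
  interpret F: pair_wf_digraph F by fact
  define hom where "hom = \<lparr> iso_verts = f, iso_arcs = map_prod f f, iso_head = snd, iso_tail = fst \<rparr>"
  define H where "H = \<lparr> pverts = f ` pverts F, parcs = map_prod f f ` parcs F \<rparr>"
  have "parcs F \<subseteq> pverts F \<times> pverts F"
    using F.wellformed' by auto
  moreover have "inj_on (map_prod f f) (pverts F \<times> pverts F)"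
    using f by (simp add: map_prod_inj_on)
  ultimately have "inj_on (map_prod f f) (parcs F)"
    by (rule inj_on_subset[rotated])
  then have "pre_digraph.digraph_isomorphism (with_proj F) hom"
    using f assms(2)
    by (simp add: pre_digraph.digraph_isomorphism_def hom_def wf_digraph_wp_iff)
  moreover have "with_proj H = app_iso hom (with_proj F)"
    by (simp add: app_iso_def hom_def H_def with_proj_def)
  moreover have "subgraph (with_proj H) (with_proj G)"
  proof -
    have "pair_wf_digraph H"
      by unfold_locales (auto simp: H_def dest: F.wellformed')
    moreover have "pverts H \<subseteq> pverts G" "parcs H \<subseteq> parcs G"
      using f by (auto simp: H_def)
    ultimately show ?thesis
      using assms(1) by (simp add: subgraph_def compatible_def wf_digraph_wp_iff)
  qed
  ultimately show "contains_subgraph G F"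
    unfolding contains_subgraph_def digraph_iso_def by blast
qed

text \<open>
  The bound \<open>i \<le> k div 2\<close> in \<^const>\<open>F_edges\<close> only selects the smaller end of an edge:
  it follows from \<open>i < j\<close> and \<open>i + j \<le> k + 1\<close>.
\<close>
lemma parcs_F_graph_iff:
  "(i, j) \<in> parcs (F_graph k) \<longleftrightarrow> 1 \<le> i \<and> 1 \<le> j \<and> i \<noteq> j \<and> i + j \<le> k + 1"
  by (auto simp: F_graph_def F_edges_def)

lemma strength_le_iff:
  assumes "pair_graph G" and "parcs G \<noteq> {}"
  shows "strength G \<le> m \<longleftrightarrow>
    (\<exists>g. numbering G g \<and> (\<forall>u v. (u, v) \<in> parcs G \<longrightarrow> g u + g v \<le> m))"
proof -
  interpret pair_graph G by fact
  have "strength_wrt g G \<le> m \<longleftrightarrow> (\<forall>u v. (u, v) \<in> parcs G \<longrightarrow> g u + g v \<le> m)" for g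
  proof -
    have "{g u + g v | u v. (u, v) \<in> parcs G} = (\<lambda>e. g (fst e) + g (snd e)) ` parcs G"
      by force
    then show ?thesis
      using pair_finite_arcs assms(2) by (auto simp: strength_wrt_def)
  qed
  then show ?thesis
    unfolding strength_def
    using Min_le_iff[OF finite_strengths[OF assms] strengths_nonempty[OF assms(1)]] by auto
qed

lemma numbering_reverse:
  assumes "numbering G g"
  shows "numbering G (\<lambda>v. card (pverts G) + 1 - g v)"
proof -
  let ?n = "card (pverts G)"
  have "bij_betw (\<lambda>i. ?n + 1 - i) {1..?n} {1..?n}"
    by (rule bij_betw_byWitness[where f' = "\<lambda>i. ?n + 1 - i"]) auto
  with assms have "bij_betw ((\<lambda>i. ?n + 1 - i) \<circ> g) (pverts G) {1..?n}"
    unfolding numbering_def by (rule bij_betw_trans)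
  then show ?thesis
    by (simp add: numbering_def comp_def)
qed

lemma numbering_bounds:
  assumes "numbering G g" and "v \<in> pverts G"
  shows "1 \<le> g v \<and> g v \<le> card (pverts G)"
  using bij_betwE[of g "pverts G" "{1..card (pverts G)}"] assms by (simp add: numbering_def)

text \<open>
  The two conditions on numberings are exchanged by \<open>numbering_reverse\<close>, since the sums of an
  edge under a numbering and under its reverse add up to \<open>2 * n + 2\<close>.
\<close>
lemma strength_le_iff_lower_bounded_numbering:
  assumes "pair_graph G" and "parcs G \<noteq> {}" and "k \<le> card (pverts G)"
  shows "strength G \<le> 2 * card (pverts G) - k \<longleftrightarrow>
    (\<exists>h. numbering G h \<and> (\<forall>u v. (u, v) \<in> parcs G \<longrightarrow> k + 2 \<le> h u + h v))"
    (is "?L \<longleftrightarrow> ?R")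
proof -
  interpret pair_graph G by fact
  let ?n = "card (pverts G)"
  have sums: "(?n + 1 - g u) + (?n + 1 - g v) + (g u + g v) = 2 * ?n + 2"
    if "numbering G g" "(u, v) \<in> parcs G" for g u v
    using numbering_bounds[OF that(1) in_arcsD1[OF that(2)]]
      numbering_bounds[OF that(1) in_arcsD2[OF that(2)]] by linarith
  show ?thesis
  proof
    assume ?L
    then obtain g where g: "numbering G g"
      and le: "\<And>u v. (u, v) \<in> parcs G \<Longrightarrow> g u + g v \<le> 2 * ?n - k"
      unfolding strength_le_iff[OF assms(1,2)] by blast
    have "k + 2 \<le> (?n + 1 - g u) + (?n + 1 - g v)" if "(u, v) \<in> parcs G" for u v
      using sums[OF g that] le[OF that] assms(3) by linarith
    then show ?R using numbering_reverse[OF g] by blast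
  next
    assume ?R
    then obtain h where h: "numbering G h"
      and ge: "\<And>u v. (u, v) \<in> parcs G \<Longrightarrow> k + 2 \<le> h u + h v"
      by blast
    have "(?n + 1 - h u) + (?n + 1 - h v) \<le> 2 * ?n - k" if "(u, v) \<in> parcs G" for u v
      using sums[OF h that] ge[OF that] assms(3) by linarith
    then show ?L
      unfolding strength_le_iff[OF assms(1,2)] using numbering_reverse[OF h] by blast
  qed
qed

lemma inj_on_extend_to_bij_betw:
  assumes "finite A" and "finite B" and "card A = card B"
    and "C \<subseteq> A" and "inj_on f C" and "f ` C \<subseteq> B"
  obtains f' where "bij_betw f' A B" and "\<And>x. x \<in> C \<Longrightarrow> f' x = f x"
proof -
  have "card (A - C) = card (B - f ` C)"
    using assms by (simp add: card_Diff_subset finite_subset card_image)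
  then obtain r where r: "bij_betw r (A - C) (B - f ` C)"
    using finite_same_card_bij[of "A - C" "B - f ` C"] assms(1,2) by auto
  let ?f' = "\<lambda>x. if x \<in> C then f x else r x"
  have "bij_betw ?f' (C \<union> (A - C)) (f ` C \<union> (B - f ` C))"
    using assms(5) r by (intro bij_betw_disjoint_Un) (auto intro: inj_on_imp_bij_betw)
  moreover have "C \<union> (A - C) = A" "f ` C \<union> (B - f ` C) = B"
    using assms(4,6) by auto
  ultimately show thesis
    using that[of ?f'] by simp
qed

text \<open>
  The inverse of \<open>h\<close>, restricted to \<open>1, \<dots>, k\<close>, is the embedding; conversely, the inverse of any
  bijection onto the vertices that extends an embedding is a suitable \<open>h\<close>. The extension is
  arbitrary because an edge with an end numbered above \<open>k\<close> satisfies the bound anyway.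
\<close>
lemma complement_contains_F_graph_iff:
  assumes "pair_graph G" and "k \<le> card (pverts G)"
  shows "contains_subgraph (graph_complement G) (F_graph k) \<longleftrightarrow>
    (\<exists>h. numbering G h \<and> (\<forall>u v. (u, v) \<in> parcs G \<longrightarrow> k + 2 \<le> h u + h v))"
    (is "?L \<longleftrightarrow> ?R")
proof -
  interpret pair_graph G by fact
  let ?V = "pverts G" and ?n = "card (pverts G)"
  let ?emb = "\<lambda>f. inj_on f {1..k} \<and> f ` {1..k} \<subseteq> ?V \<and>
      (\<forall>i j. (i, j) \<in> parcs (F_graph k) \<longrightarrow> f i \<in> ?V \<and> f j \<in> ?V \<and> f i \<noteq> f j \<and> (f i, f j) \<notin> parcs G)"
  have emb: "?L \<longleftrightarrow> (\<exists>f. ?emb f)"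
  proof -
    have "pair_wf_digraph (graph_complement G)" "pair_wf_digraph (F_graph k)"
      using pair_graph_graph_complement[OF assms(1)] pair_graph_F_graph[of k]
      by (simp_all add: pair_graph_def pair_digraph_def pair_fin_digraph_def)
    moreover have "pverts (F_graph k) = {1..k}"
      by (simp add: F_graph_def)
    ultimately show ?thesis
      by (simp add: contains_subgraph_iff_embedding graph_complement_def)
  qed
  show ?thesis
  proof
    assume ?L
    then obtain f where "?emb f"
      unfolding emb by (rule exE)
    then have f: "inj_on f {1..k}" "f ` {1..k} \<subseteq> ?V"
      and nonadj: "\<And>i j. (i, j) \<in> parcs (F_graph k) \<Longrightarrow> (f i, f j) \<notin> parcs G"
      by simp_all
    obtain f' where f': "bij_betw f' {1..?n} ?V" and f'_eq: "\<And>i. i \<in> {1..k} \<Longrightarrow> f' i = f i"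
      using inj_on_extend_to_bij_betw[of "{1..?n}" ?V "{1..k}" f] f assms(2) pair_finite_verts
      by auto
    define h where "h = inv_into {1..?n} f'"
    have h: "numbering G h"
      using bij_betw_inv_into[OF f'] by (simp add: numbering_def h_def)
    have f'h: "f' (h v) = v" if "v \<in> ?V" for v
      using bij_betw_inv_into_right[OF f' that] by (simp add: h_def)
    have "k + 2 \<le> h u + h v" if uv: "(u, v) \<in> parcs G" for u v
    proof (rule ccontr)
      assume small: "\<not> k + 2 \<le> h u + h v"
      have V: "u \<in> ?V" "v \<in> ?V"
        using uv by (auto dest: wellformed')
      have pos: "1 \<le> h u" "1 \<le> h v"
        using numbering_bounds[OF h] V by blast+
      have "u \<noteq> v"
        using uv no_loops' by blast
      then have "h u \<noteq> h v"
        using f'h[OF V(1)] f'h[OF V(2)] by metis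
      then have "(h u, h v) \<in> parcs (F_graph k)"
        using pos small unfolding parcs_F_graph_iff by simp
      moreover have "f (h u) = u" "f (h v) = v"
        using f'_eq[of "h u", symmetric] f'_eq[of "h v", symmetric] f'h V pos small by simp_all
      ultimately show False
        using nonadj[of "h u" "h v"] uv by simp
    qed
    with h show ?R by blast
  next
    assume ?R
    then obtain h where h: "bij_betw h ?V {1..?n}"
      and ge: "\<And>u v. (u, v) \<in> parcs G \<Longrightarrow> k + 2 \<le> h u + h v"
      unfolding numbering_def by blast
    define f where "f = inv_into ?V h"
    have f: "bij_betw f {1..?n} ?V"
      using bij_betw_inv_into[OF h] by (simp add: f_def)
    have hf: "h (f i) = i" if "i \<in> {1..?n}" for i
      using bij_betw_inv_into_right[OF h that] by (simp add: f_def)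
    have sub: "{1..k} \<subseteq> {1..?n}"
      using assms(2) by auto
    have "inj_on f {1..k}" "f ` {1..k} \<subseteq> ?V"
      using f sub by (auto simp: bij_betw_def intro: inj_on_subset)
    moreover have "f i \<in> ?V \<and> f j \<in> ?V \<and> f i \<noteq> f j \<and> (f i, f j) \<notin> parcs G"
      if "(i, j) \<in> parcs (F_graph k)" for i j
    proof -
      have ij: "1 \<le> i" "1 \<le> j" "i \<noteq> j" "i + j \<le> k + 1"
        using that unfolding parcs_F_graph_iff by auto
      then have mem: "i \<in> {1..?n}" "j \<in> {1..?n}"
        using assms(2) by auto
      then have "(f i, f j) \<notin> parcs G"
        using ge[of "f i" "f j"] ij(4) hf by auto
      then show ?thesis
        using mem ij(3) hf[of i] hf[of j] bij_betwE[OF f] by auto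
    qed
    ultimately have "?emb f"
      by simp
    then show ?L
      unfolding emb by (intro exI[of _ f])
  qed
qed

theorem theorem4p2:
  fixes G :: "'a pair_pre_digraph" and n k :: nat
  assumes "pair_graph G"
    and "parcs G \<noteq> {}"
    and "card (pverts G) = n"
    and "1 \<le> k" and "k \<le> n"
  shows "strength G \<ge> 2 * n - k + 1 \<longleftrightarrow>
         \<not> contains_subgraph (graph_complement G) (F_graph k)"
proof -
  have "strength G \<le> 2 * n - k \<longleftrightarrow> contains_subgraph (graph_complement G) (F_graph k)"
    using strength_le_iff_lower_bounded_numbering[of G k]
      complement_contains_F_graph_iff[of G k] assms by simp
  then show ?thesis by linarith
qed

end
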